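(* Let $L, M \subseteq \mathbb{R}^d$ be two full-rank lattices. If there exists a bounded (not necessarily measurable) set $F_1 \subseteq \mathbb{R}^d$ that is a common fundamental domain of $L$ and $M$ in $\mathbb{R}^d$, then $\mathrm{vol}(L) = \mathrm{vol}(M)$.
   Context: A full-rank lattice in $\mathbb{R}^d$ is a discrete subgroup of $\mathbb{R}^d$ whose $\mathbb{R}$-linear span is $\mathbb{R}^d$; equivalently, a set of the form $A\mathbb{Z}^d$ with $A$ a non-singular real $d\times d$ matrix. Its volume is $\mathrm{vol}(A\mathbb{Z}^d) := |\det A|$, which does not depend on the choice of $A$. A fundamental domain of a lattice $L$ in $\mathbb{R}^d$ is a set $F\subseteq\mathbb{R}^d$ that contains exactly one element of each coset of $L$ in $\mathbb{R}^d$ (exactly one, for every coset, with no null-set exceptions). A common fundamental domain of $L$ and $M$ is a single set that is a fundamental domain of $L$ and also a fundamental domain of $M$. *)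

theory Defs
  imports "HOL-Analysis.Analysis"
begin

definition additive_subgroup :: "'a::ab_group_add set \<Rightarrow> bool" where
  "additive_subgroup G \<longleftrightarrow>
     0 \<in> G \<and> (\<forall>x\<in>G. \<forall>y\<in>G. x + y \<in> G) \<and> (\<forall>x\<in>G. - x \<in> G)"

definition full_rank_lattice :: "(real ^ 'n) set \<Rightarrow> bool" where
  "full_rank_lattice L \<longleftrightarrow> additive_subgroup L \<and> discrete L \<and> span L = UNIV"

definition integer_vectors :: "(real ^ 'n) set" where
  "integer_vectors = {z. \<forall>i. z $ i \<in> \<int>}"

text \<open>The value does not depend on the choice of \<open>A\<close> (\<open>lattice_vol_eq\<close>), and such an \<open>A\<close>
  exists exactly for the full-rank lattices (\<open>full_rank_lattice_iff\<close>).\<close>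
definition lattice_vol :: "(real ^ 'n) set \<Rightarrow> real" where
  "lattice_vol L = (THE v. \<exists>A :: real ^ 'n ^ 'n.
     det A \<noteq> 0 \<and> L = (\<lambda>z. A *v z) ` integer_vectors \<and> v = \<bar>det A\<bar>)"

definition fundamental_domain :: "'a::ab_group_add set \<Rightarrow> 'a set \<Rightarrow> bool" where
  "fundamental_domain F L \<longleftrightarrow> (\<forall>x. \<exists>!y. y \<in> F \<and> y \<in> (+) x ` L)"

lemma int_matrix_det_Ints:
  fixes C :: "real ^ 'n ^ 'n"
  assumes "\<And>i j. C $ i $ j \<in> \<int>"
  shows "det C \<in> \<int>"
  unfolding det_def using assms by (auto intro!: Ints_sum Ints_mult Ints_prod)

lemma columns_in_image:
  fixes A B :: "real ^ 'n ^ 'n"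
  assumes "\<And>j. column j A \<in> (\<lambda>z. B *v z) ` integer_vectors"
  obtains C :: "real ^ 'n ^ 'n" where "\<And>i j. C $ i $ j \<in> \<int>" "A = B ** C"
proof -
  have "\<forall>j. \<exists>z. z \<in> integer_vectors \<and> column j A = B *v z"
    using assms by blast
  then obtain c where c: "\<And>j. c j \<in> integer_vectors" "\<And>j. column j A = B *v c j"
    by metis
  define C :: "real ^ 'n ^ 'n" where "C = (\<chi> i j. c j $ i)"
  have "C $ i $ j \<in> \<int>" for i j
    using c(1)[of j] by (auto simp: C_def integer_vectors_def)
  moreover have "A = B ** C"
  proof -
    have "A $ i $ j = (B ** C) $ i $ j" for i j
    proof -
      have "A $ i $ j = column j A $ i"
        by (simp add: column_def)
      also have "\<dots> = (B ** C) $ i $ j"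
        by (simp add: c(2) matrix_vector_mult_def matrix_matrix_mult_def C_def)
      finally show ?thesis .
    qed
    then show ?thesis
      by (simp add: vec_eq_iff)
  qed
  ultimately show ?thesis
    using that by blast
qed

lemma axis_integer_vector: "axis j 1 \<in> integer_vectors"
  by (auto simp: integer_vectors_def axis_def)

lemma column_in_own_image:
  fixes A :: "real ^ 'n ^ 'n"
  shows "column j A \<in> (\<lambda>z. A *v z) ` integer_vectors"
  using axis_integer_vector[of j] by (metis image_eqI matrix_vector_mult_basis)

lemma lattice_vol_eq:
  fixes A :: "real ^ 'n ^ 'n"
  assumes "det A \<noteq> 0"
  shows "lattice_vol ((\<lambda>z. A *v z) ` integer_vectors) = \<bar>det A\<bar>"
  unfolding lattice_vol_def
proof (rule the_equality)
  show "\<exists>A'. det A' \<noteq> 0 \<and>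
      (\<lambda>z. A *v z) ` integer_vectors = (\<lambda>z. A' *v z) ` integer_vectors \<and> \<bar>det A\<bar> = \<bar>det A'\<bar>"
    using assms by blast
next
  fix v
  assume "\<exists>B. det B \<noteq> 0 \<and>
      (\<lambda>z. A *v z) ` integer_vectors = (\<lambda>z. B *v z) ` integer_vectors \<and> v = \<bar>det B\<bar>"
  then obtain B :: "real ^ 'n ^ 'n" where B: "det B \<noteq> 0"
      "(\<lambda>z. A *v z) ` integer_vectors = (\<lambda>z. B *v z) ` integer_vectors" "v = \<bar>det B\<bar>"
    by blast
  obtain C where C: "\<And>i j. C $ i $ j \<in> \<int>" "A = B ** C"
    using columns_in_image[of A B] column_in_own_image[of _ A] B(2) by metis
  obtain D where D: "\<And>i j. D $ i $ j \<in> \<int>" "B = A ** D"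
    using columns_in_image[of B A] column_in_own_image[of _ B] B(2) by metis
  obtain m n :: int where mn: "det C = of_int m" "det D = of_int n"
    using int_matrix_det_Ints[of C] int_matrix_det_Ints[of D] C(1) D(1) by (metis Ints_cases)
  have dets: "det A = det B * det C" "det B = det A * det D"
    using C(2) D(2) det_mul by metis+
  then have "of_int (m * n) = (1 :: real)"
    using assms mn by (auto simp: mult.assoc mult.commute)
  then have "m * n = 1"
    by (simp only: of_int_eq_1_iff)
  then have "\<bar>m\<bar> = 1"
    by (metis abs_zmult_eq_1 abs_1)
  then have "\<bar>det C\<bar> = 1"
    using mn(1) by (metis of_int_1 of_int_abs)
  then show "v = \<bar>det A\<bar>"
    using B(3) dets(1) by (simp add: abs_mult)
qed

lemma additive_subgroup_of_int_scaleR: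
  fixes L :: "'a::real_vector set"
  assumes "additive_subgroup L" "x \<in> L"
  shows "of_int k *\<^sub>R x \<in> L"
proof -
  have nat: "of_nat n *\<^sub>R x \<in> L" for n
    using assms by (induction n) (auto simp: additive_subgroup_def algebra_simps)
  show ?thesis
  proof (cases "k \<ge> 0")
    case True
    then show ?thesis
      using nat[of "nat k"] by simp
  next
    case False
    then have "of_int k *\<^sub>R x = - (of_nat (nat (- k)) *\<^sub>R x)"
      by simp
    then show ?thesis
      using nat[of "nat (- k)"] assms by (metis additive_subgroup_def)
  qed
qed

lemma additive_subgroup_diff:
  assumes "additive_subgroup L" "x \<in> L" "y \<in> L"
  shows "x - y \<in> L"
  using assms unfolding additive_subgroup_def by (metis diff_conv_add_uminus)

lemma additive_subgroup_sum:
  assumes "additive_subgroup L" "finite I" "\<And>i. i \<in> I \<Longrightarrow> f i \<in> L"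
  shows "sum f I \<in> L"
  using assms(2,3) by (induction I) (use assms(1) in \<open>auto simp: additive_subgroup_def\<close>)

lemma additive_subgroup_combination:
  fixes A :: "real ^ 'n ^ 'n"
  assumes L: "additive_subgroup L" and A: "\<And>j. column j A \<in> L" and z: "z \<in> integer_vectors"
  shows "A *v z \<in> L"
proof -
  have "z $ j *\<^sub>R column j A \<in> L" for j
  proof -
    obtain k where "z $ j = of_int k"
      using z unfolding integer_vectors_def by (auto elim: Ints_cases)
    then show ?thesis
      using additive_subgroup_of_int_scaleR[OF L A] by metis
  qed
  then have "(\<Sum>j\<in>UNIV. z $ j *\<^sub>R column j A) \<in> L"
    by (intro additive_subgroup_sum[OF L]) auto
  then show ?thesis
    by (simp add: matrix_mult_sum scalar_mult_eq_scaleR)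
qed

lemma discrete_subgroup_uniform:
  fixes L :: "'a::real_normed_vector set"
  assumes "additive_subgroup L" "discrete L"
  shows "uniform_discrete L"
proof -
  have "0 isolated_in L"
    using assms by (auto simp: discrete_def additive_subgroup_def)
  then obtain T where T: "open T" "T \<inter> L = {0}"
    by (auto simp: isolated_in_def)
  then obtain e where e: "e > 0" "ball 0 e \<subseteq> T"
    by (metis Int_iff insertI1 openE)
  show ?thesis
  proof (rule uniformI1[OF e(1)])
    fix x y assume xy: "x \<in> L" "y \<in> L" "dist x y < e"
    then have "x - y \<in> ball 0 e"
      by (simp add: dist_norm norm_minus_commute)
    then have "x - y \<in> T \<inter> L"
      using e(2) additive_subgroup_diff[OF assms(1) xy(1,2)] by blast
    then show "x = y"
      using T(2) by simp
  qed
qed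

lemma lattice_basis_in:
  fixes L :: "(real ^ 'n) set"
  assumes "span L = UNIV"
  obtains A :: "real ^ 'n ^ 'n" where "\<And>j. column j A \<in> L" "det A \<noteq> 0"
proof -
  obtain B where B: "B \<subseteq> L" "independent B" "L \<subseteq> span B"
    by (rule basis_exists[of L]) blast
  have spanB: "span B = UNIV"
    using B(3) assms by (metis span_mono span_span top.extremum_uniqueI)
  have fin: "finite B"
    using B(2) independent_bound by blast
  have "card B = dim (span B)"
    using B(2) by (metis dim_span dim_eq_card_independent)
  then have "card B = CARD('n)"
    using spanB by simp
  then obtain b where b: "bij_betw b (UNIV :: 'n set) B"
    using fin finite_same_card_bij by (metis finite_class.finite_UNIV)
  define A :: "real ^ 'n ^ 'n" where "A = (\<chi> i j. b j $ i)"
  have col: "column j A = b j" for j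
    by (simp add: A_def column_def vec_eq_iff)
  have "columns A = B"
    using b by (auto simp: columns_def col bij_betw_def)
  then have "\<exists>A'. A ** A' = mat 1"
    using spanB by (simp add: matrix_right_invertible_span_columns span_vec_eq)
  then have "det A \<noteq> 0"
    by (simp add: invertible_det_nz[symmetric] invertible_right_inverse)
  moreover have "column j A \<in> L" for j
    using b B(1) by (auto simp: col bij_betw_def)
  ultimately show ?thesis
    using that by blast
qed

lemma invertible_eq_image:
  fixes A :: "real ^ 'n ^ 'n"
  assumes "det A \<noteq> 0"
  obtains c where "x = A *v c"
  using assms
  by (metis invertible_det_nz invertible_right_inverse matrix_vector_mul_assoc matrix_vector_mul_lid)

definition vfloor :: "real ^ 'n \<Rightarrow> real ^ 'n" where
  "vfloor c = (\<chi> i. of_int \<lfloor>c $ i\<rfloor>)"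

lemma vfloor_integer: "vfloor c \<in> integer_vectors"
  by (simp add: vfloor_def integer_vectors_def)

lemma lattice_common_denominator:
  fixes A :: "real ^ 'n ^ 'n"
  assumes L: "additive_subgroup L" "discrete L"
    and A: "\<And>j. column j A \<in> L" "det A \<noteq> 0"
  obtains N :: nat where "N > 0"
    "\<And>x. x \<in> L \<Longrightarrow> of_nat N *\<^sub>R x \<in> (\<lambda>z. A *v z) ` integer_vectors"
proof -
  let ?P = "L \<inter> (\<lambda>z. A *v z) ` cbox 0 (\<chi> i. 1)"
  have "uniform_discrete L"
    by (rule discrete_subgroup_uniform[OF L])
  then have clL: "closed L"
    by (rule uniform_discrete_imp_closed)
  have "compact ((\<lambda>z. A *v z) ` cbox 0 (\<chi> i. 1))"
    by (intro compact_continuous_image compact_cbox linear_continuous_on) auto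
  then have "compact ?P"
    using clL by (metis closed_Int_compact)
  moreover have "discrete ?P"
    using L(2) by auto
  ultimately have fin: "finite ?P"
    using discrete_compact_finite_iff by blast
  have "of_nat (fact (card ?P)) *\<^sub>R x \<in> (\<lambda>z. A *v z) ` integer_vectors" if x: "x \<in> L" for x
  proof -
    obtain c where c: "x = A *v c"
      using invertible_eq_image[OF A(2)] by blast
    define g where "g k = A *v (real k *\<^sub>R c - vfloor (real k *\<^sub>R c))" for k :: nat
    have gP: "g k \<in> ?P" for k
    proof -
      have eq: "g k = of_int (int k) *\<^sub>R x - A *v vfloor (real k *\<^sub>R c)"
        by (simp add: g_def c matrix_vector_mult_diff_distrib matrix_vector_mult_scaleR)
      have "g k \<in> L"
        unfolding eq
        by (intro additive_subgroup_diff additive_subgroup_of_int_scaleR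
            additive_subgroup_combination vfloor_integer L x A)
      moreover have "real k *\<^sub>R c - vfloor (real k *\<^sub>R c) \<in> cbox 0 (\<chi> i. 1)"
        by (auto simp: mem_box_cart vfloor_def) linarith+
      ultimately show ?thesis
        by (auto simp: g_def)
    qed
    have "card (g ` {0..card ?P}) \<le> card ?P"
      using gP fin by (intro card_mono) auto
    then have "\<not> inj_on g {0..card ?P}"
      using pigeonhole[of g "{0..card ?P}"] by auto
    then obtain k l where kl: "k < l" "l \<le> card ?P" "g k = g l"
      unfolding inj_on_def by (metis atLeastAtMost_iff linorder_neqE_nat)
    have "A *v ((real l *\<^sub>R c - vfloor (real l *\<^sub>R c)) - (real k *\<^sub>R c - vfloor (real k *\<^sub>R c))) = 0"
      using kl(3) by (simp add: g_def matrix_vector_mult_diff_distrib)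
    then have diff: "A *v (real l *\<^sub>R c - real k *\<^sub>R c)
        = A *v (vfloor (real l *\<^sub>R c) - vfloor (real k *\<^sub>R c))"
      by (simp add: matrix_vector_mult_diff_distrib algebra_simps)
    have "1 \<le> l - k" "l - k \<le> card ?P"
      using kl(1,2) by linarith+
    then have "l - k dvd (fact (card ?P) :: nat)"
      by (rule dvd_fact)
    then obtain q where q: "fact (card ?P) = (l - k) * q"
      by (auto simp: dvd_def)
    let ?z = "real q *\<^sub>R (vfloor (real l *\<^sub>R c) - vfloor (real k *\<^sub>R c))"
    have "of_nat (fact (card ?P)) *\<^sub>R x = real q *\<^sub>R (real (l - k) *\<^sub>R x)"
      by (simp only: q of_nat_mult) (simp add: mult.commute)
    also have "real (l - k) *\<^sub>R x = A *v (real l *\<^sub>R c - real k *\<^sub>R c)"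
      using kl(1) unfolding c
      by (simp add: matrix_vector_mult_scaleR of_nat_diff flip: scaleR_diff_left)
    also have "real q *\<^sub>R \<dots> = A *v ?z"
      by (simp only: diff matrix_vector_mult_scaleR)
    finally have eq: "of_nat (fact (card ?P)) *\<^sub>R x = A *v ?z" .
    have "?z \<in> integer_vectors"
      by (auto simp: integer_vectors_def vfloor_def)
    then show ?thesis
      using eq by blast
  qed
  then show ?thesis
    using that[of "fact (card ?P)"] by simp
qed

lemma full_rank_lattice_imp_matrix:
  fixes L :: "(real ^ 'n) set"
  assumes "full_rank_lattice L"
  obtains A :: "real ^ 'n ^ 'n" where "det A \<noteq> 0" "L = (\<lambda>z. A *v z) ` integer_vectors"
proof -
  have L: "additive_subgroup L" "discrete L" "span L = UNIV"
    using assms by (auto simp: full_rank_lattice_def)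
  obtain A\<^sub>0 :: "real ^ 'n ^ 'n" where A0: "\<And>j. column j A\<^sub>0 \<in> L" "det A\<^sub>0 \<noteq> 0"
    using lattice_basis_in[OF L(3)] by blast
  obtain N where N: "N > 0"
      "\<And>x. x \<in> L \<Longrightarrow> of_nat N *\<^sub>R x \<in> (\<lambda>z. A\<^sub>0 *v z) ` integer_vectors"
    using lattice_common_denominator[OF L(1,2) A0] by blast
  define S where "S = {A :: real ^ 'n ^ 'n. (\<forall>j. column j A \<in> L) \<and> det A \<noteq> 0}"
  define r where "r A = real N ^ CARD('n) * \<bar>det A\<bar> / \<bar>det A\<^sub>0\<bar>" for A :: "real ^ 'n ^ 'n"
  have r_nat: "r A \<in> \<nat>" if "A \<in> S" for A
  proof -
    have "column j (of_nat N *\<^sub>R A) = of_nat N *\<^sub>R column j A" for j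
      by (simp add: column_def vec_eq_iff)
    then have "column j (of_nat N *\<^sub>R A) \<in> (\<lambda>z. A\<^sub>0 *v z) ` integer_vectors" for j
      using N(2) that by (simp add: S_def)
    then obtain C where C: "\<And>i j. C $ i $ j \<in> \<int>" "of_nat N *\<^sub>R A = A\<^sub>0 ** C"
      using columns_in_image[of "of_nat N *\<^sub>R A" A\<^sub>0] by blast
    have "det (of_nat N *\<^sub>R A) = real N ^ CARD('n) * det A"
      using det_rows_mul[of "\<lambda>_. real N" "\<lambda>i. A $ i"]
      by (simp add: vector_scalar_mult_def scaleR_vec_def)
    then have "real N ^ CARD('n) * det A = det A\<^sub>0 * det C"
      using C(2) by (metis det_mul)
    then have "real N ^ CARD('n) * \<bar>det A\<bar> = \<bar>det A\<^sub>0\<bar> * \<bar>det C\<bar>"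
      by (metis abs_mult abs_of_nat of_nat_power)
    then have "r A = \<bar>det C\<bar>"
      using A0(2) by (simp add: r_def)
    then show ?thesis
      using int_matrix_det_Ints[of C] C(1) by (simp add: Nats_altdef2)
  qed
  have "A\<^sub>0 \<in> S"
    using A0 by (simp add: S_def)
  then obtain A where A: "A \<in> S" "\<And>B. B \<in> S \<Longrightarrow> nat \<lfloor>r A\<rfloor> \<le> nat \<lfloor>r B\<rfloor>"
    using ex_has_least_nat[of "\<lambda>A. A \<in> S" A\<^sub>0 "\<lambda>A. nat \<lfloor>r A\<rfloor>"] by blast
  have minimal: "\<bar>det A\<bar> \<le> \<bar>det B\<bar>" if "B \<in> S" for B
  proof -
    have "r A \<le> r B"
      using A(2)[OF that] r_nat[OF A(1)] r_nat[OF that] by (auto elim!: Nats_cases)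
    then show ?thesis
      using N(1) A0(2) by (simp add: r_def divide_le_cancel)
  qed
  have colA: "\<And>j. column j A \<in> L" and detA: "det A \<noteq> 0"
    using A(1) by (auto simp: S_def)
  have "x \<in> (\<lambda>z. A *v z) ` integer_vectors" if x: "x \<in> L" for x
  proof (rule ccontr)
    assume notin: "x \<notin> (\<lambda>z. A *v z) ` integer_vectors"
    obtain c where c: "x = A *v c"
      using invertible_eq_image[OF detA] by blast
    then obtain k where k: "c $ k \<notin> \<int>"
      using notin by (auto simp: integer_vectors_def)
    let ?f = "c - vfloor c"
    have fk: "?f $ k = frac (c $ k)"
      by (simp add: vfloor_def frac_def)
    have in_L: "A *v ?f \<in> L"
      using additive_subgroup_diff[OF L(1) x additive_subgroup_combination[OF L(1) colA vfloor_integer[of c]]]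
      by (simp add: c matrix_vector_mult_diff_distrib)
    define B :: "real ^ 'n ^ 'n" where "B = (\<chi> i j. if j = k then (A *v ?f) $ i else A $ i $ j)"
    have detB: "det B = frac (c $ k) * det A"
      unfolding B_def fk[symmetric] by (rule cramer_lemma)
    have "column j B = (if j = k then A *v ?f else column j A)" for j
      by (simp add: B_def column_def vec_eq_iff)
    then have "column j B \<in> L" for j
      using in_L colA by simp
    moreover have "det B \<noteq> 0"
      using detB detA k by simp
    ultimately have "\<bar>det A\<bar> \<le> \<bar>det B\<bar>"
      using minimal by (simp add: S_def)
    also have "\<dots> = frac (c $ k) * \<bar>det A\<bar>"
      by (simp add: detB abs_mult)
    also have "\<dots> < 1 * \<bar>det A\<bar>"
      using detA by (intro mult_strict_right_mono frac_lt_1) simp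
    finally show False
      by simp
  qed
  then have "L = (\<lambda>z. A *v z) ` integer_vectors"
    using additive_subgroup_combination[OF L(1) colA] by blast
  with detA that show ?thesis
    by blast
qed

lemma matrix_imp_full_rank_lattice:
  fixes A :: "real ^ 'n ^ 'n"
  assumes "det A \<noteq> 0"
  shows "full_rank_lattice ((\<lambda>z. A *v z) ` integer_vectors)" (is "full_rank_lattice ?L")
  unfolding full_rank_lattice_def
proof (intro conjI)
  show "additive_subgroup ?L"
    unfolding additive_subgroup_def
  proof (intro conjI ballI)
    show "0 \<in> ?L"
      by (rule image_eqI[of _ _ 0]) (auto simp: integer_vectors_def)
  next
    fix x y assume "x \<in> ?L" "y \<in> ?L"
    then obtain u v where "u \<in> integer_vectors" "v \<in> integer_vectors" "x = A *v u" "y = A *v v"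
      by blast
    then show "x + y \<in> ?L"
      by (intro image_eqI[of _ _ "u + v"])
        (auto simp: integer_vectors_def matrix_vector_right_distrib)
  next
    fix x assume "x \<in> ?L"
    then obtain u where "u \<in> integer_vectors" "x = A *v u"
      by blast
    then show "- x \<in> ?L"
      by (intro image_eqI[of _ _ "- u"])
        (auto simp: integer_vectors_def linear_neg[OF matrix_vector_mul_linear])
  qed
next
  obtain A' where A': "A' ** A = mat 1"
    using assms by (metis invertible_det_nz invertible_left_inverse)
  obtain K where K: "K > 0" "\<And>x. norm (A' *v x) \<le> norm x * K"
    using bounded_linear.pos_bounded[OF matrix_vector_mul_bounded_linear[of A']] by blast
  have "uniform_discrete ?L"
  proof (rule uniformI1[of "1 / K"])
    show "1 / K > 0"
      using K(1) by simp
    fix x y assume "x \<in> ?L" "y \<in> ?L" and lt: "dist x y < 1 / K"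
    then obtain u v where uv: "u \<in> integer_vectors" "v \<in> integer_vectors" "x = A *v u" "y = A *v v"
      by blast
    have "u - v = A' *v (x - y)"
      by (simp add: uv matrix_vector_mult_diff_distrib matrix_vector_mul_assoc A')
    then have "norm (u - v) \<le> norm (x - y) * K"
      using K(2) by metis
    also have "\<dots> < 1"
      using lt K(1) by (simp add: dist_norm field_simps)
    finally have lt1: "norm (u - v) < 1" .
    have "u $ i = v $ i" for i
    proof -
      have "\<bar>(u - v) $ i\<bar> < 1"
        using component_le_norm_cart[of "u - v" i] lt1 by linarith
      moreover have "(u - v) $ i \<in> \<int>"
        using uv(1,2) by (auto simp: integer_vectors_def)
      ultimately have "(u - v) $ i = 0"
        using Ints_nonzero_abs_less1 by blast
      then show ?thesis
        by simp
    qed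
    then show "x = y"
      by (simp add: uv vec_eq_iff[of u v, THEN iffD2])
  qed
  then show "discrete ?L"
    by (rule uniform_discrete_imp_discrete)
next
  have "columns A \<subseteq> ?L"
    using column_in_own_image[of _ A] by (auto simp: columns_def)
  moreover have "span (columns A) = UNIV"
    using assms
    by (metis invertible_det_nz invertible_right_inverse matrix_right_invertible_span_columns span_vec_eq)
  ultimately show "span ?L = UNIV"
    using span_mono by blast
qed

lemma full_rank_lattice_iff:
  fixes L :: "(real ^ 'n) set"
  shows "full_rank_lattice L \<longleftrightarrow>
    (\<exists>A :: real ^ 'n ^ 'n. det A \<noteq> 0 \<and> L = (\<lambda>z. A *v z) ` integer_vectors)"
  using full_rank_lattice_imp_matrix matrix_imp_full_rank_lattice by metis

end

theory Submission
  imports Defs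
begin

text \<open>
  Let \<open>F\<close> be a bounded common fundamental domain. Sending \<open>m \<in> M\<close> to \<open>m - y\<close>, where \<open>y\<close> is the
  point of \<open>F\<close> congruent to \<open>m\<close> modulo \<open>L\<close>, maps \<open>M\<close> into \<open>L\<close> and moves every point by a vector
  of \<open>F\<close>, hence by a bounded distance. The map is injective: two points with the same image have
  representatives \<open>y\<close> and \<open>y'\<close> that differ by an element of \<open>M\<close>, and \<open>F\<close> meets each coset of
  \<open>M\<close> only once (\<open>common_fundamental_domain_injection\<close>). Thus \<open>M\<close> injects into \<open>L\<close> with bounded
  displacement, so \<open>M\<close> is at most as dense as \<open>L\<close>, and by symmetry the two densities agree.

  It remains to know that the density of a lattice is the reciprocal of its volume. If \<open>P\<close> is any
  bounded measurable fundamental domain of \<open>L\<close>, its translates by the lattice points in a ball are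
  disjoint, lie in a slightly larger ball, and cover a slightly smaller one. The number of lattice
  points in a ball of radius \<open>r\<close> is therefore the volume of the ball divided by the measure of
  \<open>P\<close>, up to a bounded change of \<open>r\<close>, which is negligible in the limit
  (\<open>measure_fundamental_domain_le_if_injection\<close>). For \<open>L = A \<int>\<^sup>d\<close> the image of the half-open unit cube
  under \<open>A\<close> is such a \<open>P\<close>, and its measure is \<open>\<bar>det A\<bar>\<close>.
\<close>

section \<open>Fundamental domains\<close>

lemma fundamental_domain_eqI:
  assumes "fundamental_domain F L" "y \<in> F" "y' \<in> F" "y - x \<in> L" "y' - x \<in> L"
  shows "y = y'"
proof -
  have "y \<in> (+) x ` L" "y' \<in> (+) x ` L"
    using assms(4,5) by (force intro: image_eqI[where x = "_ - x"])+
  then show ?thesis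
    using assms(1-3) unfolding fundamental_domain_def by blast
qed

lemma fundamental_domain_obtain:
  assumes "fundamental_domain F L"
  obtains y where "y \<in> F" "y - x \<in> L"
proof -
  obtain y where "y \<in> F" "y \<in> (+) x ` L"
    using assms unfolding fundamental_domain_def by blast
  then show ?thesis
    using that by auto
qed

lemma fundamental_domain_linear_image:
  fixes f :: "'a::real_vector \<Rightarrow> 'b::real_vector"
  assumes "linear f" "bij f" "fundamental_domain F L"
  shows "fundamental_domain (f ` F) (f ` L)"
  unfolding fundamental_domain_def
proof
  fix x
  obtain u where u: "x = f u"
    using assms(2) by (meson bij_is_surj surjE)
  have inj: "f a = f b \<longleftrightarrow> a = b" for a b
    using assms(2) by (simp add: bij_is_inj inj_eq)
  have coset: "f y \<in> (+) x ` f ` L \<longleftrightarrow> y \<in> (+) u ` L" for y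
    by (auto simp: u image_iff inj simp flip: linear_add[OF assms(1)])
  have "\<exists>!y. y \<in> F \<and> y \<in> (+) u ` L"
    using assms(3) by (simp add: fundamental_domain_def)
  then obtain y where y: "y \<in> F \<and> y \<in> (+) u ` L"
      and unique: "\<forall>y'. y' \<in> F \<and> y' \<in> (+) u ` L \<longrightarrow> y' = y"
    by (rule ex1E)
  show "\<exists>!v. v \<in> f ` F \<and> v \<in> (+) x ` f ` L"
  proof (rule ex1I[of _ "f y"])
    show "f y \<in> f ` F \<and> f y \<in> (+) x ` f ` L"
      using y by (simp add: coset)
    fix v assume v: "v \<in> f ` F \<and> v \<in> (+) x ` f ` L"
    then obtain y' where y': "y' \<in> F" "v = f y'"
      by blast
    with v have "y' \<in> (+) u ` L"
      by (simp add: coset)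
    then show "v = f y"
      using y' unique by simp
  qed
qed

text \<open>
  The map is \<open>\<psi> m = m - y m\<close>, with \<open>y m\<close> the representative of \<open>m\<close> modulo \<open>L\<close> in \<open>F\<close>. If
  \<open>\<psi> m = \<psi> m'\<close>, then \<open>y m - y m' = m - m' \<in> M\<close>, so \<open>y m = y m'\<close> by uniqueness modulo \<open>M\<close>.
\<close>

lemma common_fundamental_domain_injection:
  assumes L: "additive_subgroup L"
    and F: "fundamental_domain F L" "fundamental_domain F M"
    and M: "additive_subgroup M"
  obtains \<psi> where "inj_on \<psi> M" "\<And>m. m \<in> M \<Longrightarrow> \<psi> m \<in> L" "\<And>m. m - \<psi> m \<in> F"
proof -
  have "\<forall>x. \<exists>y. y \<in> F \<and> y - x \<in> L"
    using fundamental_domain_obtain[OF F(1)] by blast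
  then obtain y where y: "\<And>x. y x \<in> F" "\<And>x. y x - x \<in> L"
    by metis
  show ?thesis
  proof (rule that[of "\<lambda>m. m - y m"])
    show "inj_on (\<lambda>m. m - y m) M"
    proof (rule inj_onI)
      fix m m' assume m: "m \<in> M" "m' \<in> M" and eq: "m - y m = m' - y m'"
      have "y m - y m' = m - m'"
        using eq by (simp add: algebra_simps)
      then have "y m - y m' \<in> M"
        using additive_subgroup_diff[OF M m] by simp
      moreover have "y m' - y m' \<in> M"
        using M by (simp add: additive_subgroup_def)
      ultimately have "y m = y m'"
        using fundamental_domain_eqI[OF F(2) y(1) y(1)] by blast
      with eq show "m = m'"
        by simp
    qed
    show "m - y m \<in> L" for m
      using y(2)[of m] L unfolding additive_subgroup_def by (metis minus_diff_eq)
    show "m - (m - y m) \<in> F" for m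
      using y(1) by simp
  qed
qed

section \<open>Counting points of a discrete subgroup in balls\<close>

lemma finite_discrete_subgroup_ball:
  fixes L :: "'a::euclidean_space set"
  assumes "additive_subgroup L" "discrete L"
  shows "finite (L \<inter> ball 0 r)"
proof -
  have "uniform_discrete (L \<inter> ball 0 r)"
    using discrete_subgroup_uniform[OF assms] by (rule uniform_discrete_subset) simp
  then show ?thesis
    by (simp add: bounded_Int flip: uniform_discrete_finite_iff)
qed

text \<open>
  Packing: the translates of \<open>P\<close> by points of \<open>L\<close> are disjoint, and those by points of the
  ball of radius \<open>r\<close> stay within the ball of radius \<open>r + D\<close>.
\<close>

lemma card_ball_times_measure_le:
  fixes L :: "'a::euclidean_space set"
  assumes L: "additive_subgroup L" "discrete L"
    and P: "fundamental_domain P L" "P \<in> lmeasurable" "P \<subseteq> ball 0 D"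
  shows "real (card (L \<inter> ball 0 r)) * measure lebesgue P \<le> measure lebesgue (ball (0 :: 'a) (r + D))"
proof -
  let ?I = "L \<inter> ball 0 r"
  note fin = finite_discrete_subgroup_ball[OF L, of r]
  have disj: "disjnt ((+) k ` P) ((+) l ` P)" if "k \<in> ?I" "l \<in> ?I" "k \<noteq> l" for k l
  proof -
    have "p = q" if "p \<in> P" "q \<in> P" "k + p = l + q" for p q
    proof -
      have "p - q = l - k"
        using \<open>k + p = l + q\<close> by (simp add: algebra_simps)
      then have "p - q \<in> L"
        using additive_subgroup_diff[OF L(1)] \<open>k \<in> ?I\<close> \<open>l \<in> ?I\<close> by simp
      moreover have "q - q \<in> L"
        using L(1) by (simp add: additive_subgroup_def)
      ultimately show ?thesis
        using fundamental_domain_eqI[OF P(1) that(1,2)] by blast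
    qed
    then show ?thesis
      using \<open>k \<noteq> l\<close> by (fastforce simp: disjnt_def)
  qed
  have "measure lebesgue (\<Union>l\<in>?I. (+) l ` P) = (\<Sum>l\<in>?I. measure lebesgue ((+) l ` P))"
    using fin P(2) disj by (intro measure_UNION') (auto intro: measurable_translation simp: pairwise_def)
  also have "\<dots> = real (card ?I) * measure lebesgue P"
    by (simp add: measure_translation)
  finally have eq: "measure lebesgue (\<Union>l\<in>?I. (+) l ` P) = real (card ?I) * measure lebesgue P" .
  have "norm (l + p) < r + D" if "l \<in> ?I" "p \<in> P" for l p
  proof -
    have "norm l < r" "norm p < D"
      using that P(3) by auto
    then show ?thesis
      using norm_triangle_ineq[of l p] by linarith
  qed
  then have "(\<Union>l\<in>?I. (+) l ` P) \<subseteq> ball 0 (r + D)"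
    by auto
  moreover have "(\<Union>l\<in>?I. (+) l ` P) \<in> lmeasurable"
    using fin P(2) by (intro fmeasurable.finite_UN) (auto intro: measurable_translation)
  ultimately show ?thesis
    unfolding eq[symmetric] by (intro measure_mono_fmeasurable) auto
qed

text \<open>
  Covering: a point of the ball of radius \<open>r\<close> lies in the translate of \<open>P\<close> by some point of \<open>L\<close>,
  and that point is at distance less than \<open>D\<close> from it.
\<close>

lemma measure_ball_le_card_times_measure:
  fixes L :: "'a::euclidean_space set"
  assumes L: "additive_subgroup L" "discrete L"
    and P: "fundamental_domain P L" "P \<in> lmeasurable" "P \<subseteq> ball 0 D"
  shows "measure lebesgue (ball (0 :: 'a) r) \<le> real (card (L \<inter> ball 0 (r + D))) * measure lebesgue P"
proof -
  let ?I = "L \<inter> ball 0 (r + D)"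
  note fin = finite_discrete_subgroup_ball[OF L, of "r + D"]
  have "x \<in> (\<Union>l\<in>?I. (+) l ` P)" if x: "x \<in> ball 0 r" for x
  proof -
    obtain p where p: "p \<in> P" "p - x \<in> L"
      using fundamental_domain_obtain[OF P(1)] by blast
    have "x - p \<in> L"
      using p(2) L(1) unfolding additive_subgroup_def by (metis minus_diff_eq)
    moreover have "norm (x - p) < r + D"
    proof -
      have "norm x < r" "norm p < D"
        using x p(1) P(3) by auto
      then show ?thesis
        using norm_triangle_ineq4[of x p] by linarith
    qed
    ultimately show ?thesis
      using p(1) by (intro UN_I[of "x - p"]) (auto intro: image_eqI[of _ _ p])
  qed
  moreover have "(\<Union>l\<in>?I. (+) l ` P) \<in> lmeasurable"
    using fin P(2) by (intro fmeasurable.finite_UN) (auto intro: measurable_translation)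
  ultimately have "measure lebesgue (ball (0 :: 'a) r) \<le> measure lebesgue (\<Union>l\<in>?I. (+) l ` P)"
    by (intro measure_mono_fmeasurable) auto
  also have "\<dots> \<le> (\<Sum>l\<in>?I. measure lebesgue ((+) l ` P))"
    using fin P(2) by (intro measure_UNION_le) (auto dest: measurable_translation)
  also have "\<dots> = real (card ?I) * measure lebesgue P"
    by (simp add: measure_translation)
  finally show ?thesis .
qed

text \<open>
  Both sides are polynomials in \<open>r\<close> of degree at most \<open>n\<close>, with \<open>p\<close> and \<open>q\<close> as coefficients of
  \<open>r ^ n\<close>; dividing by \<open>r ^ n\<close> and letting \<open>r\<close> tend to infinity compares them.
\<close>

lemma scaled_power_le_imp_le:
  fixes p q C :: real
  assumes "\<And>r. r > 0 \<Longrightarrow> r ^ n * p \<le> (r + C) ^ n * q"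
  shows "p \<le> q"
proof (rule tendsto_le)
  show "(at_top :: real filter) \<noteq> bot"
    by simp
  have "((\<lambda>r. 1 + C * inverse r) \<longlongrightarrow> 1 + C * 0) at_top"
    by (intro tendsto_intros tendsto_inverse_0_at_top filterlim_ident)
  then have "((\<lambda>r. (1 + C * inverse r) ^ n * q) \<longlongrightarrow> (1 + C * 0) ^ n * q) at_top"
    by (intro tendsto_mult tendsto_power tendsto_const)
  then show "((\<lambda>r. (1 + C * inverse r) ^ n * q) \<longlongrightarrow> q) at_top"
    by simp
  show "((\<lambda>_. p) \<longlongrightarrow> p) (at_top :: real filter)"
    by simp
  have "p \<le> (1 + C * inverse r) ^ n * q" if r: "r > 0" for r
  proof -
    have "r + C = r * (1 + C * inverse r)"
      using r by (simp add: field_simps)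
    then have "r ^ n * p \<le> r ^ n * ((1 + C * inverse r) ^ n * q)"
      using assms[OF r] by (metis mult.assoc power_mult_distrib)
    then show ?thesis
      using r by simp
  qed
  then show "\<forall>\<^sub>F r in at_top. p \<le> (1 + C * inverse r) ^ n * q"
    using eventually_gt_at_top[of 0] by (rule eventually_mono[rotated])
qed

text \<open>
  A displacement of at most \<open>R\<close> carries the points of \<open>M\<close> in a ball into \<open>L\<close> within a ball whose
  radius is larger by \<open>R\<close>. Covering for \<open>M\<close> and packing for \<open>L\<close> turn this comparison of
  cardinalities into one of ball volumes whose radii differ by a constant.
\<close>

lemma measure_fundamental_domain_le_if_injection:
  fixes L M :: "'a::euclidean_space set"
  assumes L: "additive_subgroup L" "discrete L"
    and M: "additive_subgroup M" "discrete M"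
    and P: "fundamental_domain P L" "P \<in> lmeasurable" "bounded P"
    and Q: "fundamental_domain Q M" "Q \<in> lmeasurable" "bounded Q"
    and \<psi>: "inj_on \<psi> M" "\<And>m. m \<in> M \<Longrightarrow> \<psi> m \<in> L" "\<And>m. m \<in> M \<Longrightarrow> norm (m - \<psi> m) \<le> R"
  shows "measure lebesgue P \<le> measure lebesgue Q"
proof -
  obtain D where D: "D > 0" "P \<subseteq> ball 0 D"
    using bounded_subset_ballD[OF P(3)] by blast
  obtain E where E: "E > 0" "Q \<subseteq> ball 0 E"
    using bounded_subset_ballD[OF Q(3)] by blast
  have R: "R \<ge> 0"
    using \<psi>(3)[of 0] M(1) norm_ge_zero order_trans unfolding additive_subgroup_def by blast
  let ?d = "DIM('a)" and ?C = "E + R + D"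
  have "r ^ ?d * measure lebesgue P \<le> (r + ?C) ^ ?d * measure lebesgue Q" if r: "r > 0" for r
  proof -
    have "norm (\<psi> m) < r + E + R" if "m \<in> M" "norm m < r + E" for m
      using that \<psi>(3)[of m] norm_triangle_ineq2[of "\<psi> m" m] by (simp add: norm_minus_commute)
    then have "\<psi> ` (M \<inter> ball 0 (r + E)) \<subseteq> L \<inter> ball 0 (r + E + R)"
      using \<psi>(2) by auto
    then have card: "card (M \<inter> ball 0 (r + E)) \<le> card (L \<inter> ball 0 (r + E + R))"
      using \<psi>(1) finite_discrete_subgroup_ball[OF L]
      by (intro card_inj_on_le[of \<psi>]) (auto intro: inj_on_subset)
    have "measure lebesgue (ball (0 :: 'a) r) * measure lebesgue P
        \<le> real (card (M \<inter> ball 0 (r + E))) * measure lebesgue Q * measure lebesgue P"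
      by (intro mult_right_mono measure_ball_le_card_times_measure M Q E) simp
    also have "\<dots> \<le> real (card (L \<inter> ball 0 (r + E + R))) * measure lebesgue Q * measure lebesgue P"
      using card by (intro mult_right_mono) auto
    also have "\<dots> = real (card (L \<inter> ball 0 (r + E + R))) * measure lebesgue P * measure lebesgue Q"
      by simp
    also have "\<dots> \<le> measure lebesgue (ball (0 :: 'a) (r + E + R + D)) * measure lebesgue Q"
      by (intro mult_right_mono card_ball_times_measure_le L P D) simp
    finally have "unit_ball_vol (real ?d) * (r ^ ?d * measure lebesgue P)
        \<le> unit_ball_vol (real ?d) * ((r + ?C) ^ ?d * measure lebesgue Q)"
      using r R D(1) E(1) by (simp add: content_ball add.assoc mult.assoc)
    then show ?thesis
      by (simp add: unit_ball_vol_pos)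
  qed
  then show ?thesis
    by (rule scaled_power_le_imp_le)
qed

section \<open>Linear images and Lebesgue measure\<close>

text \<open>
  The formula \<open>measure_shear_interval\<close> requires a box that is nonnegative in the direction \<open>n\<close>.
  By linearity of the shear a general box may first be translated so that its lower corner is 0.
\<close>

lemma measure_shear_cbox:
  fixes a b :: "real ^ 'n" and m n :: 'n
  assumes "m \<noteq> n"
  defines "f \<equiv> \<lambda>x :: real ^ 'n. \<chi> i. if i = m then x $ m + x $ n else x $ i"
  shows "measure lebesgue (f ` cbox a b) = measure lebesgue (cbox a b)"
proof (cases "cbox a b = {}")
  case False
  let ?B = "cbox 0 (b - a)"
  have add: "f (x + y) = f x + f y" for x y
    by (simp add: f_def vec_eq_iff)
  have box: "cbox a b = (+) a ` ?B"
    by (simp add: cbox_translation[symmetric])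
  then have "?B \<noteq> {}"
    using False by blast
  then have "measure lebesgue (f ` ?B) = measure lebesgue ?B"
    unfolding f_def by (intro measure_shear_interval assms(1)) simp_all
  moreover have "f ` cbox a b = (+) (f a) ` f ` ?B"
    by (simp add: box image_image add)
  ultimately show ?thesis
    by (metis box measure_translation)
qed simp

lemma measure_swap_cbox:
  fixes a b :: "real ^ 'n" and m n :: 'n
  defines "f \<equiv> \<lambda>x :: real ^ 'n. \<chi> i. x $ Transposition.transpose m n i"
  shows "measure lebesgue (f ` cbox a b) = measure lebesgue (cbox a b)"
proof (cases "cbox a b = {}")
  case False
  have ff: "f (f x) = x" for x
    by (simp add: f_def vec_eq_iff)
  have le: "f x \<in> cbox (f c) (f d)" if "x \<in> cbox c d" for x c d
    using that by (simp add: f_def mem_box_cart)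
  \<comment> \<open>\<open>f\<close> is an order-preserving involution, so it maps boxes onto boxes.\<close>
  have box: "f ` cbox a b = cbox (f a) (f b)"
    using le[of _ a b] le[of _ "f a" "f b"] ff
    by (metis (no_types, lifting) image_eqI image_subset_iff subsetI subset_antisym)
  then have "cbox (f a) (f b) \<noteq> {}"
    using False by blast
  then have "measure lebesgue (f ` cbox a b)
      = (\<Prod>i\<in>UNIV. (b - a) $ Transposition.transpose m n i)"
    unfolding box by (simp add: content_cbox_cart) (simp add: f_def)
  also have "\<dots> = (\<Prod>i\<in>UNIV. (b - a) $ i)"
    using prod.permute[OF permutes_swap_id[of m UNIV n], of "\<lambda>i. (b - a) $ i"] by (simp add: o_def)
  also have "\<dots> = measure lebesgue (cbox a b)"
    using False by (simp add: content_cbox_cart)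
  finally show ?thesis .
qed simp

lemma measure_matrix_image_if_cbox:
  fixes A :: "real ^ 'n ^ 'n"
  assumes "\<And>a b. measure lebesgue ((*v) A ` cbox a b) = measure lebesgue (cbox a b)"
    and "\<bar>det A\<bar> = 1" and "S \<in> lmeasurable"
  shows "(*v) A ` S \<in> lmeasurable \<and> measure lebesgue ((*v) A ` S) = \<bar>det A\<bar> * measure lebesgue S"
  using measure_linear_sufficient[OF matrix_vector_mul_linear[of A] assms(3), of 1] assms(1,2) by simp

text \<open>
  Both \<open>\<bar>det A\<bar>\<close> and the factor by which \<open>A\<close> scales Lebesgue measure are multiplicative in \<open>A\<close>,
  so it suffices to compare them for matrices with a zero row, diagonal matrices, transpositions of
  coordinates, and shears. For the last two both factors are 1, which needs to be checked on boxes only.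
\<close>

lemma measure_matrix_image:
  fixes A :: "real ^ 'n ^ 'n"
  assumes "S \<in> lmeasurable"
  shows "(*v) A ` S \<in> lmeasurable \<and> measure lebesgue ((*v) A ` S) = \<bar>det A\<bar> * measure lebesgue S"
  using assms
proof (induction A arbitrary: S rule: induct_matrix_elementary_alt)
  case (1 A B)
  note mult = this
  have eq: "(*v) (A ** B) ` S = (*v) A ` (*v) B ` S"
    by (simp add: image_image matrix_vector_mul_assoc)
  show ?case
    unfolding eq using mult by (simp add: det_mul abs_mult)
next
  case (2 A i)
  note zero_row = this
  have det: "det A = 0"
    using zero_row(1) by (rule det_zero_row)
  then have "\<not> inj ((*v) A)"
    by (metis inj_matrix_vector_mult invertible_det_nz invertible_left_inverse matrix_left_invertible_injective)
  then have "negligible ((*v) A ` S)"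
    by (intro negligible_linear_singular_image matrix_vector_mul_linear)
  then show ?case
    using det by (simp add: negligible_iff_measure)
next
  case (3 A)
  note diagonal = this
  have "A *v x = (\<chi> k. A $ k $ k * x $ k)" for x
  proof -
    have "(\<Sum>j\<in>UNIV. A $ i $ j * x $ j) = (\<Sum>j\<in>UNIV. if j = i then A $ i $ i * x $ i else 0)" for i
      using diagonal(1) by (intro sum.cong) auto
    then show ?thesis
      by (simp add: vec_eq_iff matrix_vector_mult_def)
  qed
  then have "(*v) A = (\<lambda>x. \<chi> k. A $ k $ k * x $ k)"
    by blast
  then show ?case
    using diagonal measurable_stretch[OF diagonal(2)] measure_stretch[OF diagonal(2)]
    by (simp add: det_diagonal)
next
  case (4 m n)
  note swap1 = this
  let ?A = "\<chi> i j. mat 1 $ i $ Transposition.transpose m n j :: real ^ 'n ^ 'n"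
  have "(?A *v x) $ i = x $ Transposition.transpose m n i" for x i
  proof -
    have "(i = Transposition.transpose m n j) = (j = Transposition.transpose m n i)" for j
      by (metis transpose_involutory)
    then show ?thesis
      by (simp add: matrix_vector_mult_def mat_def if_distrib[of "\<lambda>c. c * _"] cong: if_cong)
  qed
  then have "(*v) ?A = (\<lambda>x. \<chi> i. x $ Transposition.transpose m n i)"
    by (simp add: fun_eq_iff vec_eq_iff)
  moreover have "\<bar>det ?A\<bar> = 1"
    by (simp add: det_permute_columns permutes_swap_id sign_swap_id abs_mult)
  ultimately show ?case
    using swap1(2) measure_swap_cbox[of m n] by (intro measure_matrix_image_if_cbox) simp_all
next
  case (5 m n)
  note idplus = this
  let ?A = "\<chi> i j. of_bool (i = m \<and> j = n \<or> i = j) :: real ^ 'n ^ 'n"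
  have "(?A *v x) $ i = (if i = m then x $ m + x $ n else x $ i)" for x i
  proof (cases "i = m")
    case True
    have "of_bool (j = n \<or> m = j) * x $ j = (if j = n then x $ n else 0) + (if j = m then x $ m else 0)" for j
      using idplus(1) by auto
    then show ?thesis
      using True by (simp add: matrix_vector_mult_def sum.distrib)
  next
    case False
    have "of_bool (i = j) * x $ j = (if j = i then x $ i else 0)" for j
      by auto
    then show ?thesis
      using False by (simp add: matrix_vector_mult_def)
  qed
  then have "(*v) ?A = (\<lambda>x. \<chi> i. if i = m then x $ m + x $ n else x $ i)"
    by (simp add: fun_eq_iff vec_eq_iff)
  moreover have "det ?A = 1"
  proof -
    \<comment> \<open>The shear matrix arises from the identity matrix by adding row \<open>n\<close> to row \<open>m\<close>.\<close>
    have "?A = (\<chi> k. if k = m then row m (mat 1) + 1 *s row n (mat 1) else row k (mat 1))"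
      using idplus(1) by (auto simp: vec_eq_iff row_def mat_def)
    then show ?thesis
      using det_row_operation[OF idplus(1), of "mat 1 :: real ^ 'n ^ 'n" 1] by simp
  qed
  ultimately show ?case
    using idplus(2) measure_shear_cbox[OF idplus(1)] by (intro measure_matrix_image_if_cbox) simp_all
qed

section \<open>A measurable fundamental domain of a lattice\<close>

definition half_open_unit_cube :: "(real ^ 'n) set" where
  "half_open_unit_cube = {x. \<forall>i. 0 \<le> x $ i \<and> x $ i < 1}"

text \<open>
  The representative of \<open>x\<close> is its vector of fractional parts.
\<close>

lemma fundamental_domain_half_open_unit_cube:
  "fundamental_domain half_open_unit_cube (integer_vectors :: (real ^ 'n) set)"
  unfolding fundamental_domain_def
proof
  fix x :: "real ^ 'n"
  show "\<exists>!y. y \<in> half_open_unit_cube \<and> y \<in> (+) x ` integer_vectors"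
  proof (rule ex1I[of _ "x - vfloor x"])
    have "- vfloor x \<in> integer_vectors"
      using vfloor_integer[of x] by (simp add: integer_vectors_def)
    then have "x - vfloor x \<in> (+) x ` integer_vectors"
      by (intro image_eqI[of _ _ "- vfloor x"]) auto
    moreover have "x - vfloor x \<in> half_open_unit_cube"
      by (auto simp: half_open_unit_cube_def vfloor_def) linarith
    ultimately show "x - vfloor x \<in> half_open_unit_cube \<and> x - vfloor x \<in> (+) x ` integer_vectors"
      by simp
  next
    fix y assume y: "y \<in> half_open_unit_cube \<and> y \<in> (+) x ` integer_vectors"
    then obtain z where z: "z \<in> integer_vectors" "y = x + z"
      by blast
    have "y $ i = (x - vfloor x) $ i" for i
    proof -
      obtain k where k: "z $ i = of_int k"
        using z(1) by (auto simp: integer_vectors_def elim: Ints_cases)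
      have "0 \<le> x $ i + of_int k" "x $ i + of_int k < 1"
        using y unfolding half_open_unit_cube_def z(2) by (simp_all flip: k)
      then have "\<lfloor>x $ i\<rfloor> = - k"
        by linarith
      then show ?thesis
        by (simp add: z(2) k vfloor_def)
    qed
    then show "y = x - vfloor x"
      by (simp add: vec_eq_iff)
  qed
qed

lemma half_open_unit_cube_lmeasurable: "(half_open_unit_cube :: (real ^ 'n) set) \<in> lmeasurable" (is ?meas)
  and measure_half_open_unit_cube: "measure lebesgue (half_open_unit_cube :: (real ^ 'n) set) = 1" (is ?eq)
  and bounded_half_open_unit_cube: "bounded (half_open_unit_cube :: (real ^ 'n) set)" (is ?bdd)
proof -
  let ?one = "(\<chi> i. 1) :: real ^ 'n" and ?U = "half_open_unit_cube :: (real ^ 'n) set"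
  have sub: "?U \<subseteq> cbox 0 ?one" "box 0 ?one \<subseteq> ?U"
    by (auto simp: half_open_unit_cube_def mem_box_cart less_imp_le)
  then have "sym_diff (cbox 0 ?one) ?U \<subseteq> cbox 0 ?one - box 0 ?one"
    by blast
  \<comment> \<open>The cube lies between an open and a closed box, which differ by a null set.\<close>
  then have neg: "negligible (sym_diff (cbox 0 ?one) ?U)"
    using negligible_frontier_interval negligible_subset by blast
  have "cbox 0 ?one \<noteq> {}"
    by (simp add: interval_eq_empty_cart)
  then have "measure lebesgue (cbox 0 ?one) = 1"
    by (simp add: content_cbox_cart)
  then show ?eq
    using measure_negligible_symdiff[OF _ neg] by simp
  show ?meas
    using lmeasurable_negligible_symdiff[OF _ neg] by simp
  show ?bdd
    using sub(1) bounded_cbox bounded_subset by blast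
qed

lemma full_rank_lattice_measurable_fundamental_domain:
  fixes L :: "(real ^ 'n) set"
  assumes "full_rank_lattice L"
  obtains P where "fundamental_domain P L" "P \<in> lmeasurable" "bounded P"
    "measure lebesgue P = lattice_vol L"
proof -
  obtain A :: "real ^ 'n ^ 'n" where A: "det A \<noteq> 0" "L = (\<lambda>z. A *v z) ` integer_vectors"
    using full_rank_lattice_imp_matrix[OF assms] by blast
  have "invertible A"
    using A(1) by (simp add: invertible_det_nz)
  then have bij: "bij ((*v) A)"
    by (metis invertible_eq_bij)
  let ?P = "(*v) A ` half_open_unit_cube"
  show ?thesis
  proof (rule that[of ?P])
    show "fundamental_domain ?P L"
      unfolding A(2)
      by (intro fundamental_domain_linear_image bij fundamental_domain_half_open_unit_cube) simp
    show "?P \<in> lmeasurable"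
      using measure_matrix_image[OF half_open_unit_cube_lmeasurable] by blast
    show "bounded ?P"
      by (intro bounded_linear_image bounded_half_open_unit_cube) simp
    have "measure lebesgue ?P = \<bar>det A\<bar>"
      using measure_matrix_image[OF half_open_unit_cube_lmeasurable, of A]
      by (simp add: measure_half_open_unit_cube)
    then show "measure lebesgue ?P = lattice_vol L"
      using lattice_vol_eq[OF A(1)] A(2) by simp
  qed
qed

section \<open>Equality of volumes\<close>

lemma lattice_vol_le_if_bounded_common_fundamental_domain:
  fixes L M :: "(real ^ 'n) set"
  assumes L: "full_rank_lattice L" and M: "full_rank_lattice M"
    and F: "bounded F" "fundamental_domain F L" "fundamental_domain F M"
  shows "lattice_vol L \<le> lattice_vol M"
proof -
  have sub: "additive_subgroup L" "discrete L" "additive_subgroup M" "discrete M"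
    using L M by (auto simp: full_rank_lattice_def)
  obtain P where P: "fundamental_domain P L" "P \<in> lmeasurable" "bounded P"
      "measure lebesgue P = lattice_vol L"
    using full_rank_lattice_measurable_fundamental_domain[OF L] .
  obtain Q where Q: "fundamental_domain Q M" "Q \<in> lmeasurable" "bounded Q"
      "measure lebesgue Q = lattice_vol M"
    using full_rank_lattice_measurable_fundamental_domain[OF M] .
  obtain R where R: "\<And>x. x \<in> F \<Longrightarrow> norm x \<le> R"
    using F(1) by (auto simp: bounded_iff)
  obtain \<psi> where \<psi>: "inj_on \<psi> M" "\<And>m. m \<in> M \<Longrightarrow> \<psi> m \<in> L" "\<And>m. m - \<psi> m \<in> F"
    using common_fundamental_domain_injection[OF sub(1) F(2,3) sub(3)] by blast
  have "measure lebesgue P \<le> measure lebesgue Q"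
    using \<psi>(3) R by (intro measure_fundamental_domain_le_if_injection[OF sub P(1-3) Q(1-3) \<psi>(1,2)]) auto
  then show ?thesis
    using P(4) Q(4) by simp
qed

theorem corollary4p1:
  fixes L M :: "(real ^ 'n) set"
  assumes "full_rank_lattice L" and "full_rank_lattice M"
    and "\<exists>F\<^sub>1 :: (real ^ 'n) set.
           bounded F\<^sub>1 \<and> fundamental_domain F\<^sub>1 L \<and> fundamental_domain F\<^sub>1 M"
  shows "lattice_vol L = lattice_vol M"
  using assms lattice_vol_le_if_bounded_common_fundamental_domain by (meson order_antisym)

end
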